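(* Let $G=(V,E,\omega,m)$ be a finite connected weighted graph and let $n$ be a positive integer. For each $j\in\mathbb{N}$ let $f_{1,j},\dots,f_{n,j}:V\to\mathbb{R}$ be functions, let $c_j\in\mathbb{R}$, and let $u_j:V\to\mathbb{R}$ be a solution of $$-\Delta u_j(x)=\sum_{i=1}^n f_{i,j}(x)e^{iu_j(x)}+c_j,\qquad x\in V.$$ Suppose that $\lim_{j\to+\infty}f_{i,j}=f_i$ for every $1\leqslant i\leqslant n$ and $\lim_{j\to+\infty}c_j=c$, where $f_i:V\to\mathbb{R}$ and $c\in\mathbb{R}$. Then there exists a subsequence $\{u_{j_k}\}$ satisfying one of the following alternatives: (1) $\{u_{j_k}\}$ is uniformly bounded; or (2) $u_{j_k}\to-\infty$ uniformly on $V$; or (3) $u_{j_k}\to+\infty$ uniformly on $V$.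
   Context: A finite connected weighted graph $G=(V,E,\omega,m)$ consists of a finite connected graph $(V,E)$, a positive vertex weight $m:V\to(0,\infty)$, and a symmetric edge weight $\omega:V\times V\to[0,\infty)$, $\omega_{xy}=\omega_{yx}$, with $\omega_{xy}>0$ if and only if $\{x,y\}\in E$ (written $x\sim y$). The graph Laplacian of $u:V\to\mathbb{R}$ is $\Delta u(x)=\frac{1}{m(x)}\sum_{y\sim x}\omega_{xy}(u(y)-u(x))$. *)

theory Defs
  imports Complex_Main
begin

text \<open>
  The graph is \<open>(V, E)\<close> with \<open>E\<close> a set of unordered pairs \<open>{x, y}\<close> of vertices. Loops \<open>{x}\<close> are
  not excluded; they contribute nothing to the Laplacian. Weights and functions on vertices are
  total functions on the ambient type, of which only the values on \<open>V\<close> matter.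
\<close>

locale finite_connected_graph =
  fixes V :: "'a set" and E :: "'a set set"
  assumes finite_V: "finite V"
    and V_nonempty: "V \<noteq> {}"
    and E_subset: "E \<subseteq> {{x, y} | x y. x \<in> V \<and> y \<in> V}"
    and connected: "\<And>x y. x \<in> V \<Longrightarrow> y \<in> V \<Longrightarrow> (x, y) \<in> {(a, b). {a, b} \<in> E}\<^sup>*"

locale finite_connected_weighted_graph = finite_connected_graph V E
  for V :: "'a set" and E :: "'a set set" +
  fixes \<omega> :: "'a \<Rightarrow> 'a \<Rightarrow> real" and m :: "'a \<Rightarrow> real"
  assumes m_pos: "\<And>x. x \<in> V \<Longrightarrow> m x > 0"
    and \<omega>_nonneg: "\<And>x y. x \<in> V \<Longrightarrow> y \<in> V \<Longrightarrow> \<omega> x y \<ge> 0"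
    and \<omega>_sym: "\<And>x y. x \<in> V \<Longrightarrow> y \<in> V \<Longrightarrow> \<omega> x y = \<omega> y x"
    and \<omega>_pos_iff: "\<And>x y. x \<in> V \<Longrightarrow> y \<in> V \<Longrightarrow> \<omega> x y > 0 \<longleftrightarrow> {x, y} \<in> E"

definition graph_laplacian ::
    "'a set \<Rightarrow> 'a set set \<Rightarrow> ('a \<Rightarrow> 'a \<Rightarrow> real) \<Rightarrow> ('a \<Rightarrow> real) \<Rightarrow> ('a \<Rightarrow> real) \<Rightarrow> 'a \<Rightarrow> real" where
  "graph_laplacian V E \<omega> m u x =
     1 / m x * (\<Sum>y \<in> {y \<in> V. {x, y} \<in> E}. \<omega> x y * (u y - u x))"

definition uniformly_bounded_on :: "'a set \<Rightarrow> (nat \<Rightarrow> 'a \<Rightarrow> real) \<Rightarrow> bool" where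
  "uniformly_bounded_on V v \<longleftrightarrow> (\<exists>B. \<forall>k. \<forall>x \<in> V. \<bar>v k x\<bar> \<le> B)"

definition uniformly_to_minus_infinity_on :: "'a set \<Rightarrow> (nat \<Rightarrow> 'a \<Rightarrow> real) \<Rightarrow> bool" where
  "uniformly_to_minus_infinity_on V v \<longleftrightarrow> (\<forall>B. \<exists>K. \<forall>k \<ge> K. \<forall>x \<in> V. v k x \<le> B)"

definition uniformly_to_plus_infinity_on :: "'a set \<Rightarrow> (nat \<Rightarrow> 'a \<Rightarrow> real) \<Rightarrow> bool" where
  "uniformly_to_plus_infinity_on V v \<longleftrightarrow> (\<forall>B. \<exists>K. \<forall>k \<ge> K. \<forall>x \<in> V. v k x \<ge> B)"

end

theory Submission imports Defs "HOL-Library.Infinite_Set" begin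

text \<open>
  Where a family of functions is bounded above, the equation bounds their Laplacians. If all of them
  have their minimum at the same vertex \<open>x0\<close>, then every summand of the Laplacian at a vertex \<open>y\<close> is
  bounded below in terms of \<open>u y - u x0\<close>, so that a bound on the Laplacian at \<open>y\<close> bounds \<open>u - u x0\<close>
  at the neighbours of \<open>y\<close>. By connectedness the oscillation is bounded as soon as the minima are
  bounded above, and a subsequence behaves like the sequence of its minima.
\<close>

text \<open>The Laplacian is assumed bounded only where \<open>u y \<le> u x0 + K\<close>, because
  the equation controls its exponentials only where the solution is bounded above. \<open>M\<close>
  may depend on \<open>K\<close> but not on \<open>u\<close>, so the resulting bound is uniform over
  \<open>U\<close>.\<close>

lemma (in finite_connected_weighted_graph) oscillation_bounded_above:
  fixes U :: "('a \<Rightarrow> real) set"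
  assumes x0: "x0 \<in> V"
    and min: "\<And>u y. u \<in> U \<Longrightarrow> y \<in> V \<Longrightarrow> u x0 \<le> u y"
    and laplacian: "\<And>K. \<exists>M. \<forall>u \<in> U. \<forall>y \<in> V. u y \<le> u x0 + K \<longrightarrow> graph_laplacian V E \<omega> m u y \<le> M"
  shows "\<exists>K. \<forall>u \<in> U. \<forall>y \<in> V. u y \<le> u x0 + K"
proof -
  \<comment> \<open>The bound propagates along a path from \<open>x0\<close>, with a larger constant
    after each edge.\<close>
  have ex: "\<exists>K. \<forall>u \<in> U. u y \<le> u x0 + K" if "(x0, y) \<in> {(a, b). {a, b} \<in> E}\<^sup>*" for y
    using that
  proof (induction rule: rtrancl_induct)
    case base
    show ?case by (rule exI [of _ 0]) simp
  next
    case (step y z)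
    then obtain K where K: "\<forall>u \<in> U. u y \<le> u x0 + K" by blast
    obtain M where M: "\<forall>u \<in> U. \<forall>y \<in> V. u y \<le> u x0 + K \<longrightarrow> graph_laplacian V E \<omega> m u y \<le> M"
      using laplacian by blast
    have yz: "{y, z} \<in> E" using step.hyps by simp
    then have yV: "y \<in> V" and zV: "z \<in> V" using E_subset by (auto simp: doubleton_eq_iff)
    have pos: "\<omega> y z > 0" using \<omega>_pos_iff yV zV yz by blast
    let ?N = "{w \<in> V. {y, w} \<in> E}"
    \<comment> \<open>\<open>m y * M\<close> bounds the full sum in the Laplacian at
      \<open>y\<close>; the second term compensates for the neighbours other than \<open>z\<close>,
      whose summands are at least \<open>- \<omega> y w * K\<close>.\<close>
    let ?T = "m y * M + (\<Sum>w \<in> ?N - {z}. \<omega> y w * K)"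
    have "u z \<le> u x0 + (K + ?T / \<omega> y z)" if u: "u \<in> U" for u
    proof -
      have uy: "u y \<le> u x0 + K" using K u by blast
      then have "graph_laplacian V E \<omega> m u y \<le> M" using M u yV by blast
      then have "(\<Sum>w \<in> ?N. \<omega> y w * (u w - u y)) \<le> m y * M"
        using m_pos [OF yV] unfolding graph_laplacian_def by (simp add: field_simps)
      moreover have "(\<Sum>w \<in> ?N. \<omega> y w * (u w - u y))
          = \<omega> y z * (u z - u y) + (\<Sum>w \<in> ?N - {z}. \<omega> y w * (u w - u y))"
        by (rule sum.remove) (use finite_V zV yz in auto)
      \<comment> \<open>Minimality at \<open>x0\<close> enters here:
        \<open>u w \<ge> u x0 \<ge> u y - K\<close>.\<close>
      moreover have "(\<Sum>w \<in> ?N - {z}. \<omega> y w * (- K)) \<le> (\<Sum>w \<in> ?N - {z}. \<omega> y w * (u w - u y))"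
      proof (intro sum_mono mult_left_mono)
        fix w assume w: "w \<in> ?N - {z}"
        then show "- K \<le> u w - u y" using min [OF u, of w] uy by simp
        show "0 \<le> \<omega> y w" using w \<omega>_nonneg yV by simp
      qed
      ultimately have "\<omega> y z * (u z - u y) \<le> ?T" by (simp add: sum_negf)
      then have "u z - u y \<le> ?T / \<omega> y z" using pos by (simp add: pos_le_divide_eq mult.commute)
      then show ?thesis using uy by linarith
    qed
    then show ?case by blast
  qed
  then have "\<forall>y \<in> V. \<exists>K. \<forall>u \<in> U. u y \<le> u x0 + K" using connected [OF x0] by blast
  then obtain k where k: "\<And>y u. y \<in> V \<Longrightarrow> u \<in> U \<Longrightarrow> u y \<le> u x0 + k y" by metis
  have "u y \<le> u x0 + Max (k ` V)" if "u \<in> U" "y \<in> V" for u y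
  proof -
    have "k y \<le> Max (k ` V)" using finite_V that by simp
    then show ?thesis using k [OF that(2,1)] by linarith
  qed
  then show ?thesis by blast
qed

lemma convergent_family_bounded:
  fixes g :: "'i \<Rightarrow> nat \<Rightarrow> real"
  assumes "finite I" and "\<And>i. i \<in> I \<Longrightarrow> g i \<longlonglongrightarrow> l i"
  shows "\<exists>B \<ge> 0. \<forall>i \<in> I. \<forall>j. \<bar>g i j\<bar> \<le> B"
proof -
  have "\<forall>i \<in> I. \<exists>B. \<forall>j. \<bar>g i j\<bar> \<le> B"
  proof
    fix i assume "i \<in> I"
    then have "Bseq (g i)" using assms(2) convergent_imp_Bseq convergentI by blast
    then show "\<exists>B. \<forall>j. \<bar>g i j\<bar> \<le> B" unfolding Bseq_def real_norm_def by blast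
  qed
  then obtain b where b: "\<And>i j. i \<in> I \<Longrightarrow> \<bar>g i j\<bar> \<le> b i" by metis
  have b0: "b i \<ge> 0" if "i \<in> I" for i using b [OF that, of 0] by linarith
  \<comment> \<open>The sum of the individual bounds dominates each of them, and it is nonnegative
    even for empty \<open>I\<close>.\<close>
  have "\<bar>g i j\<bar> \<le> sum b I" if "i \<in> I" for i j
    using b [OF that, of j] member_le_sum [of i I b] that b0 assms(1) by fastforce
  then show ?thesis using sum_nonneg [of I b] b0 by blast
qed

lemma subsequence_of_frequently:
  assumes "\<exists>\<^sub>F j in sequentially. P j"
  obtains r :: "nat \<Rightarrow> nat" where "strict_mono r" and "\<And>k. P (r k)"
proof -
  have "infinite {j. P j}" using assms by (simp add: cofinite_eq_sequentially [symmetric] frequently_cofinite)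
  then show ?thesis using infinite_enumerate that by blast
qed

text \<open>Pigeonhole: each \<open>u j\<close> attains its minimum on the finite set
  \<open>V\<close>, so some vertex is a minimiser for infinitely many \<open>j\<close>.\<close>

lemma subsequence_with_common_minimum:
  fixes u :: "nat \<Rightarrow> 'a \<Rightarrow> real"
  assumes "finite V" and "V \<noteq> {}"
  obtains x0 r where "x0 \<in> V" and "strict_mono (r :: nat \<Rightarrow> nat)"
    and "\<And>k y. y \<in> V \<Longrightarrow> u (r k) x0 \<le> u (r k) y"
proof -
  have "\<forall>j. \<exists>x \<in> V. \<forall>y \<in> V. u j x \<le> u j y"
    using assms by (metis arg_min_if_finite(1) arg_min_least)
  then have "\<exists>\<^sub>F j in sequentially. \<exists>x \<in> V. \<forall>y \<in> V. u j x \<le> u j y"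
    by (simp add: eventually_frequently)
  then obtain x0 where "x0 \<in> V" "\<exists>\<^sub>F j in sequentially. \<forall>y \<in> V. u j x0 \<le> u j y"
    by (auto dest: frequently_bex_finite [OF assms(1)])
  moreover from this(2) obtain r :: "nat \<Rightarrow> nat" where "strict_mono r" "\<And>k. \<forall>y \<in> V. u (r k) x0 \<le> u (r k) y"
    by (rule subsequence_of_frequently) blast
  ultimately show ?thesis using that by blast
qed

theorem theorem1p1:
  fixes V :: "'a set" and E :: "'a set set"
    and \<omega> :: "'a \<Rightarrow> 'a \<Rightarrow> real" and m :: "'a \<Rightarrow> real"
    and n :: nat
    and f :: "nat \<Rightarrow> nat \<Rightarrow> 'a \<Rightarrow> real" and f_lim :: "nat \<Rightarrow> 'a \<Rightarrow> real"
    and c :: "nat \<Rightarrow> real" and c_lim :: real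
    and u :: "nat \<Rightarrow> 'a \<Rightarrow> real"
  assumes graph: "finite_connected_weighted_graph V E \<omega> m"
    and n_pos: "n \<ge> 1"
    and solution: "\<And>j x. x \<in> V \<Longrightarrow>
      - graph_laplacian V E \<omega> m (u j) x = (\<Sum>i = 1..n. f i j x * exp (real i * u j x)) + c j"
    and f_conv: "\<And>i x. 1 \<le> i \<Longrightarrow> i \<le> n \<Longrightarrow> x \<in> V \<Longrightarrow> (\<lambda>j. f i j x) \<longlonglongrightarrow> f_lim i x"
    and c_conv: "c \<longlonglongrightarrow> c_lim"
  shows "\<exists>r :: nat \<Rightarrow> nat. strict_mono r \<and>
      (uniformly_bounded_on V (\<lambda>k. u (r k))
       \<or> uniformly_to_minus_infinity_on V (\<lambda>k. u (r k))
       \<or> uniformly_to_plus_infinity_on V (\<lambda>k. u (r k)))"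
proof -
  interpret finite_connected_weighted_graph V E \<omega> m by (rule graph)
  obtain x0 r where x0: "x0 \<in> V" and r: "strict_mono (r :: nat \<Rightarrow> nat)"
    and min: "\<And>k y. y \<in> V \<Longrightarrow> u (r k) x0 \<le> u (r k) y"
    by (rule subsequence_with_common_minimum [OF finite_V V_nonempty, of u]) blast
  let ?a = "\<lambda>k::nat. u (r k) x0"
  show ?thesis
  proof (cases "filterlim ?a at_top sequentially")
    case True
    have "uniformly_to_plus_infinity_on V (\<lambda>k. u (r k))"
      unfolding uniformly_to_plus_infinity_on_def
    proof
      fix B
      obtain K where "\<forall>k \<ge> K. B \<le> ?a k"
        using True unfolding filterlim_at_top eventually_sequentially by blast
      then show "\<exists>K. \<forall>k \<ge> K. \<forall>x \<in> V. B \<le> u (r k) x" using min by (meson order_trans)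
    qed
    then show ?thesis using r by blast
  next
    case False
    \<comment> \<open>If the minima do not tend to infinity, infinitely many of them stay below some
      level \<open>C\<close>; the oscillation bound becomes available along these indices.\<close>
    then obtain C where "\<exists>\<^sub>F k in sequentially. ?a k \<le> C"
      by (auto simp: filterlim_at_top not_eventually not_le intro: frequently_elim1 less_imp_le)
    then obtain s :: "nat \<Rightarrow> nat" where s: "strict_mono s" and aC: "\<And>k. ?a (s k) \<le> C"
      by (rule subsequence_of_frequently) blast
    let ?v = "\<lambda>k. u (r (s k))"
    have rs: "strict_mono (\<lambda>k. r (s k))" using r s by (simp add: strict_mono_def)
    obtain F where F: "F \<ge> 0" "\<And>i x j. i \<in> {1..n} \<Longrightarrow> x \<in> V \<Longrightarrow> \<bar>f i j x\<bar> \<le> F"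
      \<comment> \<open>Indexing by pairs of an exponent and a vertex makes a single
        \<open>F\<close> serve all coefficients, vertices and \<open>j\<close>.\<close>
      using convergent_family_bounded [of "{1..n} \<times> V" "\<lambda>(i, x) j. f i j x" "\<lambda>(i, x). f_lim i x"]
        finite_V f_conv by auto
    obtain D where D: "\<And>j. \<bar>c j\<bar> \<le> D"
      using convergent_family_bounded [of "{()}" "\<lambda>_. c" "\<lambda>_. c_lim"] c_conv by auto
    have "\<exists>K. \<forall>w \<in> range ?v. \<forall>y \<in> V. w y \<le> w x0 + K"
    proof (rule oscillation_bounded_above [OF x0])
      fix w y assume "w \<in> range ?v" "y \<in> V"
      then show "w x0 \<le> w y" using min by auto
    next
      fix K
      \<comment> \<open>Where \<open>u j y \<le> C + K\<close>, the \<open>i\<close>-th exponential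
        is at most \<open>exp (real i * (C + K))\<close>. With \<open>F\<close> and \<open>D\<close>
        bounding the coefficients in absolute value, the equation bounds the Laplacian from above,
        whatever the signs of the coefficients.\<close>
      let ?M = "(\<Sum>i = 1..n. F * exp (real i * (C + K))) + D"
      have "graph_laplacian V E \<omega> m (u j) y \<le> ?M" if j: "u j x0 \<le> C" "u j y \<le> u j x0 + K" and y: "y \<in> V"
        for j y
      proof -
        have "- (f i j y * exp (real i * u j y)) \<le> F * exp (real i * (C + K))" if i: "i \<in> {1..n}" for i
        proof -
          have "- (f i j y * exp (real i * u j y)) \<le> \<bar>f i j y\<bar> * exp (real i * u j y)"
            by (metis abs_ge_minus_self abs_mult abs_exp_cancel)
          also have "\<dots> \<le> F * exp (real i * (C + K))"
            using F(1) F(2) [OF i y] j by (intro mult_mono) (auto intro!: mult_left_mono)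
          finally show ?thesis .
        qed
        then have "- (\<Sum>i = 1..n. f i j y * exp (real i * u j y)) \<le> (\<Sum>i = 1..n. F * exp (real i * (C + K)))"
          unfolding sum_negf [symmetric] by (rule sum_mono)
        then show ?thesis using solution [OF y, of j] D [of j] by linarith
      qed
      then show "\<exists>M. \<forall>w \<in> range ?v. \<forall>y \<in> V. w y \<le> w x0 + K \<longrightarrow> graph_laplacian V E \<omega> m w y \<le> M"
        using aC by blast
    qed
    then obtain K where K: "\<And>k y. y \<in> V \<Longrightarrow> ?v k y \<le> ?v k x0 + K" by blast
    show ?thesis
    proof (cases "filterlim (\<lambda>k. ?v k x0) at_bot sequentially")
      case True
      have "uniformly_to_minus_infinity_on V ?v"
        unfolding uniformly_to_minus_infinity_on_def
      proof
        fix B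
        obtain N where N: "\<forall>k \<ge> N. ?v k x0 \<le> B - K"
          using True unfolding filterlim_at_bot eventually_sequentially by blast
        \<comment> \<open>The value at \<open>x\<close> exceeds the minimum by at most
          \<open>K\<close>, hence the threshold \<open>B - K\<close> for the minima.\<close>
        have "?v k x \<le> B" if "k \<ge> N" "x \<in> V" for k x
          using N that K [of x k] by force
        then show "\<exists>N. \<forall>k \<ge> N. \<forall>x \<in> V. ?v k x \<le> B" by blast
      qed
      then show ?thesis using rs by (intro exI [of _ "\<lambda>k. r (s k)"]) simp
    next
      case False
      then obtain A where "\<exists>\<^sub>F k in sequentially. A \<le> ?v k x0"
        by (auto simp: filterlim_at_bot not_eventually not_le intro: frequently_elim1 less_imp_le)
      then obtain t :: "nat \<Rightarrow> nat" where t: "strict_mono t" and aA: "\<And>k. A \<le> ?v (t k) x0"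
        by (rule subsequence_of_frequently) blast
      \<comment> \<open>On this last subsequence the minima lie between \<open>A\<close> and
        \<open>C\<close>, so all values lie between \<open>A\<close> and
        \<open>C + K\<close>.\<close>
      have "\<bar>?v (t k) x\<bar> \<le> \<bar>A\<bar> + \<bar>C + K\<bar>" if "x \<in> V" for k x
        using aA [of k] aC [of "t k"] K [OF that, of "t k"] min [OF that, of "s (t k)"] by linarith
      then have "uniformly_bounded_on V (\<lambda>k. ?v (t k))" unfolding uniformly_bounded_on_def by blast
      moreover have "strict_mono (\<lambda>k. r (s (t k)))" using rs t by (simp add: strict_mono_def)
      ultimately show ?thesis by (intro exI [of _ "\<lambda>k. r (s (t k))"]) simp
    qed
  qed
qed

end
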